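(* Let $\mathcal{H}$ be a $k$-uniform hypergraph with $n$ vertices and $m\ge1$ edges, and let $\mathbf{A}_\mathcal{L}$ be the adjacency matrix of its line multigraph. (a) If $m=n$, then $\mathtt{QE}(\mathcal{H})=\mathtt{E}(\mathbf{A}_\mathcal{L})$. (b) If $m<n$, then $\mathtt{QE}(\mathcal{H})-\frac{2km(n-m)}{n}\le \mathtt{E}(\mathbf{A}_\mathcal{L}) < \mathtt{QE}(\mathcal{H})$, and the first inequality is an equality if and only if the edges of $\mathcal{H}$ are pairwise disjoint. (c) If $m>n$, then $\mathtt{QE}(\mathcal{H})<\mathtt{E}(\mathbf{A}_\mathcal{L})<\mathtt{QE}(\mathcal{H})+2k(m-n)$.
   Context: A hypergraph $\mathcal{H}=(V,E)$ with $|V|=n$, $|E|=m$ is $k$-uniform ($k\ge2$) if every edge has exactly $k$ vertices. Its incidence matrix $\mathbf{B}$ is the $n\times m$ matrix with $b(v,e)=1$ if $v\in e$ and $0$ otherwise; the signless Laplacian matrix is $\mathbf{Q}=\mathbf{B}\mathbf{B}^T$. The average degree is $d(\mathcal{H})=km/n$. The signless Laplacian energy is $\mathtt{QE}(\mathcal{H})=\sum_{i=1}^n|\lambda_i(\mathbf{Q})-d(\mathcal{H})|$. The line multigraph $\mathcal{L}(\mathcal{H})$ has vertex set $E$, and the number of edges between distinct $e,f\in E$ is $|e\cap f|$; its adjacency matrix $\mathbf{A}_\mathcal{L}$ is the $m\times m$ matrix with entry $|e\cap f|$ for $e\ne f$ and $0$ on the diagonal (so $\mathbf{B}^T\mathbf{B}=k\mathbf{I}+\mathbf{A}_\mathcal{L}$).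 For a symmetric matrix $\mathbf{M}$, $\mathtt{E}(\mathbf{M})$ is the sum of absolute values of its eigenvalues. *)

theory Defs
  imports
    "HOL-Computational_Algebra.Polynomial"
    "Jordan_Normal_Form.Char_Poly"
begin

definition uniform_hypergraph :: "nat \<Rightarrow> 'a set \<Rightarrow> 'a set set \<Rightarrow> bool" where
  "uniform_hypergraph k V E \<longleftrightarrow>
     k \<ge> 2 \<and> finite V \<and> (\<forall>e\<in>E. e \<subseteq> V \<and> card e = k)"

(* Matrices are indexed by natural numbers, so the vertices and the edges are listed
   without repetition; the spectra do not depend on the chosen lists. *)
definition enumeration :: "'b list \<Rightarrow> 'b set \<Rightarrow> bool" where
  "enumeration xs A \<longleftrightarrow> distinct xs \<and> set xs = A"

definition incidence_matrix :: "'a list \<Rightarrow> 'a set list \<Rightarrow> real mat" where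
  "incidence_matrix vs es =
     mat (length vs) (length es) (\<lambda>(i, j). if vs ! i \<in> es ! j then 1 else 0)"

definition signless_laplacian :: "'a list \<Rightarrow> 'a set list \<Rightarrow> real mat" where
  "signless_laplacian vs es = incidence_matrix vs es * (incidence_matrix vs es)\<^sup>T"

definition line_adjacency_matrix :: "'a set list \<Rightarrow> real mat" where
  "line_adjacency_matrix es =
     mat (length es) (length es)
       (\<lambda>(i, j). if i = j then 0 else real (card (es ! i \<inter> es ! j)))"

(* Real eigenvalues with algebraic multiplicity. For a real symmetric matrix these
   are all eigenvalues, and there are as many of them as rows. *)
definition eigenvalues :: "real mat \<Rightarrow> real multiset" where
  "eigenvalues M = proots (char_poly M)"

definition matrix_energy :: "real mat \<Rightarrow> real" where
  "matrix_energy M = (\<Sum>x\<in>#eigenvalues M. \<bar>x\<bar>)"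

definition average_degree :: "nat \<Rightarrow> 'a list \<Rightarrow> 'a set list \<Rightarrow> real" where
  "average_degree k vs es = real k * real (length es) / real (length vs)"

definition signless_laplacian_energy :: "nat \<Rightarrow> 'a list \<Rightarrow> 'a set list \<Rightarrow> real" where
  "signless_laplacian_energy k vs es =
     (\<Sum>x\<in>#eigenvalues (signless_laplacian vs es). \<bar>x - average_degree k vs es\<bar>)"

end

theory Submission
  imports Defs "Jordan_Normal_Form.Schur_Decomposition"
begin

text \<open>
  Write \<open>B\<close> for the incidence matrix and \<open>d = km/n\<close>. The spectra of \<open>Q = BB\<^sup>T\<close> and
  \<open>B\<^sup>TB = kI + A\<close> differ only in the multiplicity of \<open>0\<close>, and both sum to \<open>km\<close>. Let \<open>X\<close> be
  the smaller of the two, \<open>a\<close> the mean of \<open>X\<close> and \<open>b\<close> the mean of the other one, so that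
  \<open>{a, b} = {k, d}\<close> and \<open>b < a\<close> if \<open>m \<noteq> n\<close>. One of the two energies is \<open>\<Sum>\<bar>x - a\<bar>\<close> and the
  other is \<open>\<Sum>\<bar>x - b\<bar> + \<bar>X\<bar>(a - b)\<close>, with \<open>x\<close> ranging over \<open>X\<close>, because the additional
  zeros contribute \<open>\<bar>X\<bar>(a - b)\<close>. The triangle inequality compares them. The first is strictly
  smaller since some \<open>x\<close> reaches the mean \<open>a > b\<close>; the second exceeds it by the maximal amount
  \<open>2\<bar>X\<bar>(a - b)\<close> only if every \<open>x\<close> is at least \<open>a\<close>, hence equal to \<open>a\<close>. Then the symmetric
  matrix with spectrum \<open>X\<close> is scalar. For \<open>B\<^sup>TB\<close> this says that the edges are pairwise disjoint;
  for \<open>Q\<close> it is impossible, as two vertices of a common edge give a nonzero off-diagonal entry.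
\<close>

section \<open>Triangularization of real symmetric matrices\<close>

text \<open>For an eigenvector \<open>v\<close>, the Hermitian form \<open>S\<close> of
  \<open>M\<close> at \<open>v\<close> equals \<open>a * N\<close>, where \<open>N\<close> is the
  squared norm of \<open>v\<close>. Since \<open>M\<close> is real and symmetric, exchanging the
  summation indices shows that \<open>S\<close> is its own conjugate. As \<open>N\<close> is real
  and nonzero, \<open>a\<close> is real.\<close>

lemma symmetric_eigenvalue_real:
  fixes M :: "real mat"
  assumes M: "M \<in> carrier_mat n n" and sym: "M\<^sup>T = M"
    and ev: "eigenvalue (map_mat complex_of_real M) a"
  shows "a \<in> \<real>"
proof -
  let ?A = "map_mat complex_of_real M"
  from ev M obtain v where v: "v \<in> carrier_vec n" "v \<noteq> 0\<^sub>v n" and av: "?A *\<^sub>v v = a \<cdot>\<^sub>v v"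
    unfolding eigenvalue_def eigenvector_def by auto
  have Msym: "M $$ (i, j) = M $$ (j, i)" if "i < n" "j < n" for i j
    using that M index_transpose_mat(1)[of i M j] sym by auto
  have avi: "a * v $ i = (\<Sum>j<n. of_real (M $$ (i, j)) * v $ j)" if "i < n" for i
  proof -
    have "a * v $ i = (?A *\<^sub>v v) $ i" using av v that by simp
    also have "\<dots> = (\<Sum>j<n. of_real (M $$ (i, j)) * v $ j)"
      using that M v by (auto simp: scalar_prod_def atLeast0LessThan)
    finally show ?thesis .
  qed
  define N where "N = (\<Sum>i<n. v $ i * cnj (v $ i))"
  define S where "S = (\<Sum>i<n. \<Sum>j<n. of_real (M $$ (i, j)) * v $ j * cnj (v $ i))"
  have aN: "a * N = S"
    unfolding N_def S_def sum_distrib_left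
    by (intro sum.cong refl) (simp add: mult.assoc[symmetric] avi sum_distrib_right)
  have "cnj S = (\<Sum>i<n. \<Sum>j<n. of_real (M $$ (i, j)) * cnj (v $ j) * v $ i)"
    unfolding S_def by simp
  also have "\<dots> = (\<Sum>j<n. \<Sum>i<n. of_real (M $$ (i, j)) * cnj (v $ j) * v $ i)"
    by (rule sum.swap)
  also have "\<dots> = S" unfolding S_def
    by (intro sum.cong refl) (auto simp: Msym ac_simps)
  finally have cS: "cnj S = S" .
  have cN: "cnj N = N" unfolding N_def by (simp add: mult.commute)
  have N_eq: "N = of_real (\<Sum>i<n. (cmod (v $ i))\<^sup>2)"
    unfolding N_def of_real_sum by (intro sum.cong refl) (simp only: complex_norm_square)
  have "N \<noteq> 0"
  proof
    assume "N = 0"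
    hence "(\<Sum>i<n. (cmod (v $ i))\<^sup>2) = 0" using N_eq by (simp only: of_real_eq_0_iff)
    hence "\<forall>i<n. v $ i = 0" by (subst (asm) sum_nonneg_eq_0_iff) auto
    hence "v = 0\<^sub>v n" using v by (intro eq_vecI) auto
    thus False using v by simp
  qed
  moreover have "cnj a * N = a * N" using aN cS cN by (metis complex_cnj_mult)
  ultimately show ?thesis by (simp add: Reals_cnj_iff)
qed

text \<open>The characteristic polynomial factors over the complex numbers, and its roots are
  eigenvalues, hence real. The factorization descends to the reals because the embedding of real
  into complex polynomials is injective.\<close>

lemma symmetric_char_poly_splits:
  fixes M :: "real mat"
  assumes M: "M \<in> carrier_mat n n" and sym: "M\<^sup>T = M"
  shows "\<exists>as. char_poly M = (\<Prod>a\<leftarrow>as. [:- a, 1:])"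
proof -
  let ?A = "map_mat complex_of_real M"
  have A: "?A \<in> carrier_mat n n" using M by simp
  obtain as where as: "char_poly ?A = (\<Prod>a\<leftarrow>as. [:- a, 1:])"
    using char_poly_factorized[OF A] by blast
  have real: "complex_of_real (Re a) = a" if "a \<in> set as" for a
  proof -
    have "poly (char_poly ?A) a = 0" unfolding as
      using that by (auto simp: poly_prod_list prod_list_zero_iff)
    hence "a \<in> \<real>"
      using symmetric_eigenvalue_real[OF M sym] eigenvalue_root_char_poly[OF A] by blast
    thus ?thesis by simp
  qed
  interpret h: map_poly_inj_comm_ring_hom complex_of_real ..
  have "map_poly complex_of_real (char_poly M) = (\<Prod>a\<leftarrow>as. [:- a, 1:])"
    using as by (simp add: of_real_hom.char_poly_hom[OF M])
  also have "\<dots> = (\<Prod>a\<leftarrow>map Re as. map_poly complex_of_real [:- a, 1:])"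
    by (rule arg_cong[where f = prod_list]) (auto simp: real)
  also have "\<dots> = map_poly complex_of_real (\<Prod>a\<leftarrow>map Re as. [:- a, 1:])"
    by (simp add: h.hom_prod_list o_def)
  finally show ?thesis using h.injectivity by blast
qed

text \<open>This takes the place of the spectral theorem: a triangular form over the reals already
  shows all eigenvalues on its diagonal and preserves traces.\<close>

lemma symmetric_similar_upper_triangular:
  fixes M :: "real mat"
  assumes M: "M \<in> carrier_mat n n" and sym: "M\<^sup>T = M"
  obtains T where "T \<in> carrier_mat n n" "upper_triangular T" "similar_mat M T"
  using symmetric_char_poly_splits[OF assms] schur_decomposition_exists[OF M] by blast

section \<open>Eigenvalue multisets read off a triangular form\<close>

lemma proots_linear_factors: "proots (\<Prod>a\<leftarrow>as. [:- a, 1:]) = mset (as :: 'a :: idom list)"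
proof (induction as)
  case (Cons a as)
  have "(\<Prod>a\<leftarrow>as. [:- a, 1:]) \<noteq> (0 :: 'a poly)" by (auto simp: prod_list_zero_iff)
  with Cons show ?case by (simp add: proots_mult del: mult_pCons_left)
qed simp

lemma eigenvalues_similar_upper_triangular:
  assumes "T \<in> carrier_mat n n" "upper_triangular T" "similar_mat M T"
  shows "eigenvalues M = mset (diag_mat T)"
  using assms char_poly_similar[of M T] char_poly_upper_triangular[of T n]
  by (simp add: eigenvalues_def proots_linear_factors)

lemma size_eigenvalues_symmetric:
  assumes M: "M \<in> carrier_mat n n" and sym: "M\<^sup>T = M"
  shows "size (eigenvalues M) = n"
proof -
  obtain T where "T \<in> carrier_mat n n" "upper_triangular T" "similar_mat M T"
    using symmetric_similar_upper_triangular[OF assms] .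
  from eigenvalues_similar_upper_triangular[OF this] this(1) show ?thesis
    by (simp add: diag_mat_def)
qed

text \<open>A scalar matrix is fixed by conjugation, so the matrices that triangularize
  \<open>M\<close> also triangularize the shifted matrix, and the diagonal moves by
  \<open>c\<close>.\<close>

lemma eigenvalues_add_scalar:
  assumes M: "M \<in> carrier_mat n n" and sym: "M\<^sup>T = M"
  shows "eigenvalues (M + c \<cdot>\<^sub>m 1\<^sub>m n) = image_mset (\<lambda>x. x + c) (eigenvalues M)"
proof -
  obtain T where T: "T \<in> carrier_mat n n" and ut: "upper_triangular T" and s: "similar_mat M T"
    using symmetric_similar_upper_triangular[OF assms] .
  from s obtain P Q where "similar_mat_wit M T P Q" unfolding similar_mat_def by blast
  note w = similar_mat_witD2[OF M this]
  have cI: "c \<cdot>\<^sub>m 1\<^sub>m n \<in> carrier_mat n n" by simp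
  have "P * (T + c \<cdot>\<^sub>m 1\<^sub>m n) * Q = (P * T + P * (c \<cdot>\<^sub>m 1\<^sub>m n)) * Q"
    by (subst mult_add_distrib_mat[OF w(6) w(5) cI]) simp
  also have "P * (c \<cdot>\<^sub>m 1\<^sub>m n) = c \<cdot>\<^sub>m P" using w(6)
    by (subst mult_smult_distrib[OF w(6), of _ n]) auto
  also have "(P * T + c \<cdot>\<^sub>m P) * Q = P * T * Q + c \<cdot>\<^sub>m P * Q"
    using w by (intro add_mult_distrib_mat) auto
  also have "c \<cdot>\<^sub>m P * Q = c \<cdot>\<^sub>m (P * Q)" by (rule mult_smult_assoc_mat[OF w(6) w(7)])
  finally have eq: "M + c \<cdot>\<^sub>m 1\<^sub>m n = P * (T + c \<cdot>\<^sub>m 1\<^sub>m n) * Q" using w by simp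
  have "similar_mat (M + c \<cdot>\<^sub>m 1\<^sub>m n) (T + c \<cdot>\<^sub>m 1\<^sub>m n)"
    by (rule similar_matI[OF _ w(1) w(2) eq]) (use w T M in auto)
  moreover have "upper_triangular (T + c \<cdot>\<^sub>m 1\<^sub>m n)"
    using ut T by (auto simp: upper_triangular_def)
  ultimately have "eigenvalues (M + c \<cdot>\<^sub>m 1\<^sub>m n) = mset (diag_mat (T + c \<cdot>\<^sub>m 1\<^sub>m n))"
    using T by (intro eigenvalues_similar_upper_triangular[of _ n]) auto
  also have "diag_mat (T + c \<cdot>\<^sub>m 1\<^sub>m n) = map (\<lambda>x. x + c) (diag_mat T)"
    using T by (auto simp: diag_mat_def)
  finally show ?thesis using eigenvalues_similar_upper_triangular[OF T ut s] by simp
qed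


section \<open>Traces\<close>

definition mat_trace :: "'a :: comm_semiring_1 mat \<Rightarrow> 'a" where
  "mat_trace A = (\<Sum>i<dim_row A. A $$ (i, i))"

lemma mat_trace_mult:
  assumes "A \<in> carrier_mat n m" "B \<in> carrier_mat m n"
  shows "mat_trace (A * B) = (\<Sum>i<n. \<Sum>j<m. A $$ (i, j) * B $$ (j, i))"
  using assms by (auto simp: mat_trace_def scalar_prod_def atLeast0LessThan)

lemma mat_trace_mult_commute:
  assumes "A \<in> carrier_mat n m" "B \<in> carrier_mat m n"
  shows "mat_trace (A * B) = mat_trace (B * A)"
  unfolding mat_trace_mult[OF assms] mat_trace_mult[OF assms(2,1)]
  by (subst sum.swap) (simp add: mult.commute)

lemma mat_trace_similar:
  assumes "similar_mat A B"
  shows "mat_trace A = mat_trace B"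
proof -
  obtain n P Q where c: "{A, B, P, Q} \<subseteq> carrier_mat n n" and QP: "Q * P = 1\<^sub>m n"
    and A: "A = P * B * Q"
    using similar_matD[OF assms] by blast
  have "mat_trace A = mat_trace (Q * (P * B))"
    unfolding A using c by (intro mat_trace_mult_commute) auto
  also have "Q * (P * B) = B"
    using c QP by (metis assoc_mult_mat insert_subset left_mult_one_mat)
  finally show ?thesis .
qed

lemma sum_eigenvalues_symmetric:
  assumes M: "M \<in> carrier_mat n n" and sym: "M\<^sup>T = M"
  shows "\<Sum>\<^sub># (eigenvalues M) = mat_trace M"
proof -
  obtain T where T: "T \<in> carrier_mat n n" "upper_triangular T" "similar_mat M T"
    using symmetric_similar_upper_triangular[OF assms] .
  have "\<Sum>\<^sub># (eigenvalues M) = sum_list (diag_mat T)"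
    by (simp add: eigenvalues_similar_upper_triangular[OF T] sum_mset_sum_list)
  also have "\<dots> = mat_trace T"
    by (simp add: diag_mat_def mat_trace_def sum_list_sum_nth atLeast0LessThan)
  finally show ?thesis using mat_trace_similar[OF T(3)] by simp
qed

text \<open>Both sides are the trace of \<open>M * M\<close>: the right one by symmetry of
  \<open>M\<close>, the left one after passing to a triangular \<open>T\<close>, whose square has
  the squared diagonal entries of \<open>T\<close> on its diagonal.\<close>

lemma sum_square_eigenvalues_symmetric:
  assumes M: "M \<in> carrier_mat n n" and sym: "M\<^sup>T = M"
  shows "(\<Sum>x\<in>#eigenvalues M. x\<^sup>2) = (\<Sum>i<n. \<Sum>j<n. (M $$ (i, j))\<^sup>2)"
proof -
  obtain T where T: "T \<in> carrier_mat n n" and ut: "upper_triangular T" and s: "similar_mat M T"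
    using symmetric_similar_upper_triangular[OF assms] .
  have Msym: "M $$ (j, i) = M $$ (i, j)" if "i < n" "j < n" for i j
    using that M index_transpose_mat(1)[of i M j] sym by auto
  have diag: "(\<Sum>j<n. T $$ (i, j) * T $$ (j, i)) = (T $$ (i, i))\<^sup>2" if "i < n" for i
  proof -
    \<comment> \<open>One of the two positions lies below the diagonal.\<close>
    have "T $$ (i, j) * T $$ (j, i) = 0" if "j < n" "j \<noteq> i" for j
      using ut T that \<open>i < n\<close> by (cases "j < i") (auto simp: upper_triangular_def)
    hence "(\<Sum>j<n. T $$ (i, j) * T $$ (j, i)) = (\<Sum>j\<in>{i}. T $$ (i, j) * T $$ (j, i))"
      using \<open>i < n\<close> by (intro sum.mono_neutral_right) auto
    thus ?thesis by (simp add: power2_eq_square)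
  qed
  from s obtain P Q where "similar_mat_wit M T P Q" unfolding similar_mat_def by blast
  hence "similar_mat (M ^\<^sub>m 2) (T ^\<^sub>m 2)"
    unfolding similar_mat_def using similar_mat_wit_pow by blast
  hence s2: "similar_mat (M * M) (T * T)" using M T by (simp add: numeral_2_eq_2)
  have "(\<Sum>x\<in>#eigenvalues M. x\<^sup>2) = (\<Sum>x\<leftarrow>diag_mat T. x\<^sup>2)"
    unfolding eigenvalues_similar_upper_triangular[OF T ut s]
    by (metis mset_map sum_mset_sum_list)
  also have "\<dots> = (\<Sum>i<n. (T $$ (i, i))\<^sup>2)"
    using T by (simp add: diag_mat_def sum_list_sum_nth atLeast0LessThan)
  also have "\<dots> = mat_trace (T * T)"
    using T by (simp add: mat_trace_mult diag)
  also have "\<dots> = mat_trace (M * M)" using mat_trace_similar[OF s2] by simp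
  also have "\<dots> = (\<Sum>i<n. \<Sum>j<n. (M $$ (i, j))\<^sup>2)"
    unfolding mat_trace_mult[OF M M] power2_eq_square
    by (intro sum.cong refl) (simp add: Msym)
  finally show ?thesis .
qed

text \<open>After the shift by \<open>- c\<close> all eigenvalues are zero, so the squares of the
  entries of \<open>N\<close> sum to zero and every entry vanishes.\<close>

lemma symmetric_eq_scalar_if_eigenvalues_eq:
  fixes M :: "real mat"
  assumes M: "M \<in> carrier_mat n n" and sym: "M\<^sup>T = M" and c: "\<forall>x\<in>#eigenvalues M. x = c"
  shows "M = c \<cdot>\<^sub>m 1\<^sub>m n"
proof -
  define N where "N = M + (- c) \<cdot>\<^sub>m 1\<^sub>m n"
  have N: "N \<in> carrier_mat n n" using M by (simp add: N_def)
  have symN: "N\<^sup>T = N"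
  proof (rule eq_matI)
    fix i j assume "i < dim_row N" "j < dim_col N"
    thus "N\<^sup>T $$ (i, j) = N $$ (i, j)"
      using M sym index_transpose_mat(1)[of i M j] by (auto simp: N_def)
  qed (use N in auto)
  have "(\<Sum>i<n. \<Sum>j<n. (N $$ (i, j))\<^sup>2) = (\<Sum>x\<in>#eigenvalues N. x\<^sup>2)"
    using sum_square_eigenvalues_symmetric[OF N symN] by simp
  also have "eigenvalues N = image_mset (\<lambda>x. x + (- c)) (eigenvalues M)"
    unfolding N_def by (rule eigenvalues_add_scalar[OF M sym])
  also have "\<dots> = image_mset (\<lambda>x. 0) (eigenvalues M)"
    using c by (intro image_mset_cong) auto
  finally have "(\<Sum>i<n. \<Sum>j<n. (N $$ (i, j))\<^sup>2) = 0"
    by (simp add: multiset.map_comp o_def)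
  hence "\<forall>i<n. (\<Sum>j<n. (N $$ (i, j))\<^sup>2) = 0"
    by (subst (asm) sum_nonneg_eq_0_iff) (auto intro: sum_nonneg)
  hence "N $$ (i, j) = 0" if "i < n" "j < n" for i j
    using that by (auto simp: sum_nonneg_eq_0_iff)
  thus ?thesis using M by (intro eq_matI) (force simp: N_def)+
qed


section \<open>The spectra of \<open>AB\<close> and \<open>BA\<close>\<close>

lemma char_poly_four_block_upper_right_zero:
  fixes A D :: "'a :: idom mat"
  assumes A: "A \<in> carrier_mat n n" and C: "C \<in> carrier_mat m n" and D: "D \<in> carrier_mat m m"
  shows "char_poly (four_block_mat A (0\<^sub>m n m) C D) = char_poly A * char_poly D"
proof -
  have "char_poly_matrix (four_block_mat A (0\<^sub>m n m) C D) =
    four_block_mat (char_poly_matrix A) (0\<^sub>m n m) (map_mat (\<lambda>a. [:- a:]) C) (char_poly_matrix D)"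
    using assms by (intro eq_matI) (auto simp: char_poly_matrix_def)
  thus ?thesis unfolding char_poly_def
    using assms by (simp add: det_four_block_mat_upper_right_zero[of _ n _ m])
qed

lemma char_poly_zero_mat: "char_poly (0\<^sub>m n n :: 'a :: idom mat) = [:0, 1:] ^ n"
  by (subst char_poly_upper_triangular[of _ n]) (auto simp: upper_triangular_def prod_list_replicate)

text \<open>The block matrices \<open>[[AB, 0], [B, 0]]\<close> and \<open>[[0, 0], [B, BA]]\<close> are conjugate
  by \<open>[[1, A], [0, 1]]\<close>.\<close>

lemma char_poly_mult_commute:
  fixes A B :: "'a :: idom mat"
  assumes A: "A \<in> carrier_mat n m" and B: "B \<in> carrier_mat m n"
  shows "char_poly (A * B) * [:0, 1:] ^ m = char_poly (B * A) * [:0, 1:] ^ n"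
proof -
  let ?X = "four_block_mat (A * B) (0\<^sub>m n m) B (0\<^sub>m m m)"
  let ?Y = "four_block_mat (0\<^sub>m n n) (0\<^sub>m n m) B (B * A)"
  let ?P = "four_block_mat (1\<^sub>m n) A (0\<^sub>m m n) (1\<^sub>m m)"
  let ?Q = "four_block_mat (1\<^sub>m n) (- A) (0\<^sub>m m n) (1\<^sub>m m)"
  have one: "four_block_mat (1\<^sub>m n) (0\<^sub>m n m) (0\<^sub>m m n) (1\<^sub>m m) = (1\<^sub>m (n + m) :: 'a mat)"
    by (intro eq_matI) auto
  have minus0: "- 0\<^sub>m m m + 1\<^sub>m m = (1\<^sub>m m :: 'a mat)"
    by (intro eq_matI) auto
  have minusA: "A + - A = 0\<^sub>m n m"
    using A by (intro eq_matI) auto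
  have PQ: "?P * ?Q = 1\<^sub>m (n + m)"
    using A by (subst mult_four_block_mat[of _ n n _ m _ m _ _ n _ m]) (auto simp: one minus0 minusA)
  have QP: "?Q * ?P = 1\<^sub>m (n + m)"
    using A by (subst mult_four_block_mat[of _ n n _ m _ m _ _ n _ m]) (auto simp: one minus0 minusA)
  have PY: "?P * ?Y = four_block_mat (A * B) (A * (B * A)) B (B * A)"
    using A B by (subst mult_four_block_mat[of _ n n _ m _ m _ _ n _ m]) auto
  \<comment> \<open>Applied with \<open>A * B\<close> and with \<open>B\<close> in place of
    \<open>X\<close>, this clears the right column of blocks in \<open>?P * ?Y * ?Q\<close>.\<close>
  have cancel: "X * (- A) + (X * A) * 1\<^sub>m m = 0\<^sub>m l m"
    if "X \<in> carrier_mat l n" for X :: "'a mat" and l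
    using that A by (intro eq_matI) (auto simp: scalar_prod_def sum_negf)
  have BA: "A * (B * A) = A * B * A"
    using assoc_mult_mat[OF A B A] by simp
  have "?P * ?Y * ?Q = four_block_mat
      (A * B * 1\<^sub>m n + A * (B * A) * 0\<^sub>m m n) (A * B * (- A) + A * (B * A) * 1\<^sub>m m)
      (B * 1\<^sub>m n + B * A * 0\<^sub>m m n) (B * (- A) + B * A * 1\<^sub>m m)"
    unfolding PY
    by (rule mult_four_block_mat[of _ n n _ m _ m _ _ n _ m]) (use A B in auto)
  also have "\<dots> = ?X"
    unfolding BA cancel[OF B] cancel[OF mult_carrier_mat[OF A B]] using A B by simp
  finally have X: "?X = ?P * ?Y * ?Q" ..
  have "similar_mat ?X ?Y"
    by (rule similar_matI[OF _ PQ QP X]) (use A B in auto)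
  from char_poly_similar[OF this] show ?thesis
    using A B by (simp add: char_poly_four_block_upper_right_zero char_poly_zero_mat mult.commute)
qed

lemma char_poly_nonzero: "A \<in> carrier_mat n n \<Longrightarrow> char_poly (A :: 'a :: idom mat) \<noteq> 0"
  using degree_monic_char_poly[of A n] by auto

text \<open>\<open>proots\<close> turns products of nonzero polynomials into sums of multisets.
  Padding both sides with zeros treats all orders of \<open>n\<close> and \<open>m\<close> at
  once.\<close>

lemma eigenvalues_mult_commute:
  assumes A: "A \<in> carrier_mat n m" and B: "B \<in> carrier_mat m n"
  shows "eigenvalues (A * B) + replicate_mset m 0 = eigenvalues (B * A) + replicate_mset n 0"
proof -
  have X: "proots ([:0, 1:] ^ k :: real poly) = replicate_mset k 0" for k
    by (simp add: proots_power multiset_eq_iff)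
  have "char_poly (A * B) \<noteq> 0" "char_poly (B * A) \<noteq> 0"
    using A B by (auto intro!: char_poly_nonzero)
  thus ?thesis
    using arg_cong[OF char_poly_mult_commute[OF assms], of proots]
    by (simp add: eigenvalues_def proots_mult X)
qed


section \<open>Comparing absolute deviations\<close>

lemma sum_mset_nonneg_eq_0_iff:
  fixes f :: "'b \<Rightarrow> real"
  assumes "\<forall>x\<in>#X. 0 \<le> f x"
  shows "(\<Sum>x\<in>#X. f x) = 0 \<longleftrightarrow> (\<forall>x\<in>#X. f x = 0)"
    and "0 \<le> (\<Sum>x\<in>#X. f x)"
proof -
  have "((\<Sum>x\<in>#X. f x) = 0 \<longleftrightarrow> (\<forall>x\<in>#X. f x = 0)) \<and> 0 \<le> (\<Sum>x\<in>#X. f x)"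
    using assms by (induction X) auto
  thus "(\<Sum>x\<in>#X. f x) = 0 \<longleftrightarrow> (\<forall>x\<in>#X. f x = 0)" "0 \<le> (\<Sum>x\<in>#X. f x)" by auto
qed

lemma abs_deviation_comparison:
  fixes X :: "real multiset"
  assumes ne: "X \<noteq> {#}" and mean: "\<Sum>\<^sub># X = real (size X) * a" and "b < a"
  defines "F \<equiv> \<lambda>c. \<Sum>x\<in>#X. \<bar>x - c\<bar>"
  shows "F a < F b + real (size X) * (a - b)"
    and "F b \<le> F a + real (size X) * (a - b)"
    and "F b = F a + real (size X) * (a - b) \<longleftrightarrow> (\<forall>x\<in>#X. x = a)"
proof -
  have sum_const: "(\<Sum>x\<in>#X. f x + c) = (\<Sum>x\<in>#X. f x) + real (size X) * c"
    for f :: "real \<Rightarrow> real" and c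
    by (induction X) (auto simp: algebra_simps)
  have sum_diff: "(\<Sum>x\<in>#X. f x - g x) = (\<Sum>x\<in>#X. f x) - (\<Sum>x\<in>#X. g x)"
    for f g :: "real \<Rightarrow> real"
    by (induction X) auto
  have dev0: "(\<Sum>x\<in>#X. x - a) = 0"
    using sum_const[of "\<lambda>x. x" "- a"] mean by simp
  \<comment> \<open>The slack in the triangle inequality for \<open>\<bar>x - a\<bar>\<close>
    through \<open>b\<close>; it vanishes exactly if \<open>x \<le> b\<close>.\<close>
  define u where "u = (\<lambda>x. \<bar>x - b\<bar> - \<bar>x - a\<bar> + (a - b))"
  have u0: "\<forall>x\<in>#X. 0 \<le> u x" using \<open>b < a\<close> by (auto simp: u_def)
  have sum_u: "(\<Sum>x\<in>#X. u x) = F b - F a + real (size X) * (a - b)"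
    unfolding u_def sum_const sum_diff F_def ..
  have "(\<Sum>x\<in>#X. u x) \<noteq> 0"
  proof
    assume "(\<Sum>x\<in>#X. u x) = 0"
    hence "\<forall>x\<in>#X. x \<le> b"
      using sum_mset_nonneg_eq_0_iff(1)[OF u0] \<open>b < a\<close> by (auto simp: u_def abs_if split: if_splits)
    \<comment> \<open>A nonempty multiset with all elements below \<open>a\<close> cannot have mean
      \<open>a\<close>.\<close>
    hence neg: "\<forall>x\<in>#X. x < a" using \<open>b < a\<close> by force
    have "(\<Sum>x\<in>#X. a - x) = 0" using dev0 by (simp add: sum_diff)
    hence "\<forall>x\<in>#X. a - x = 0" using neg by (subst (asm) sum_mset_nonneg_eq_0_iff) auto
    thus False using neg ne by (auto dest: multi_nonempty_split)
  qed
  with sum_mset_nonneg_eq_0_iff(2)[OF u0] sum_u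
  show "F a < F b + real (size X) * (a - b)" by simp
  \<comment> \<open>The slack in the opposite triangle inequality; it vanishes exactly if
    \<open>a \<le> x\<close>.\<close>
  define w where "w = (\<lambda>x. \<bar>x - a\<bar> - \<bar>x - b\<bar> + (a - b))"
  have w0: "\<forall>x\<in>#X. 0 \<le> w x" using \<open>b < a\<close> by (auto simp: w_def)
  have sum_w: "(\<Sum>x\<in>#X. w x) = F a - F b + real (size X) * (a - b)"
    unfolding w_def sum_const sum_diff F_def ..
  show "F b \<le> F a + real (size X) * (a - b)"
    using sum_mset_nonneg_eq_0_iff(2)[OF w0] sum_w by simp
  show "F b = F a + real (size X) * (a - b) \<longleftrightarrow> (\<forall>x\<in>#X. x = a)"
  proof
    assume "F b = F a + real (size X) * (a - b)"
    hence "(\<Sum>x\<in>#X. w x) = 0" using sum_w by simp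
    hence "\<forall>x\<in>#X. a \<le> x"
      using sum_mset_nonneg_eq_0_iff(1)[OF w0] \<open>b < a\<close> by (auto simp: w_def abs_if split: if_splits)
    \<comment> \<open>The deviations from the mean sum to zero and are now nonnegative.\<close>
    hence "\<forall>x\<in>#X. x - a = 0"
      using dev0 by (subst (asm) sum_mset_nonneg_eq_0_iff) auto
    thus "\<forall>x\<in>#X. x = a" by simp
  next
    assume "\<forall>x\<in>#X. x = a"
    hence "\<forall>x\<in>#X. w x = 0" using \<open>b < a\<close> by (auto simp: w_def)
    hence "(\<Sum>x\<in>#X. w x) = 0" using sum_mset_nonneg_eq_0_iff(1)[OF w0] by blast
    thus "F b = F a + real (size X) * (a - b)" using sum_w by simp
  qed
qed


section \<open>The incidence matrix\<close>

lemma incidence_matrix_carrier [simp]: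
  "incidence_matrix vs es \<in> carrier_mat (length vs) (length es)"
  by (simp add: incidence_matrix_def)

lemma line_adjacency_matrix_carrier [simp]:
  "line_adjacency_matrix es \<in> carrier_mat (length es) (length es)"
  by (simp add: line_adjacency_matrix_def)

lemma signless_laplacian_carrier [simp]:
  "signless_laplacian vs es \<in> carrier_mat (length vs) (length vs)"
  by (simp add: signless_laplacian_def incidence_matrix_def carrier_matI)

lemma transpose_gram:
  fixes B :: "'a :: comm_semiring_1 mat"
  shows "(B * B\<^sup>T)\<^sup>T = B * B\<^sup>T" "(B\<^sup>T * B)\<^sup>T = B\<^sup>T * B"
proof -
  have B: "B \<in> carrier_mat (dim_row B) (dim_col B)" "B\<^sup>T \<in> carrier_mat (dim_col B) (dim_row B)"
    by auto
  show "(B * B\<^sup>T)\<^sup>T = B * B\<^sup>T" "(B\<^sup>T * B)\<^sup>T = B\<^sup>T * B"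
    unfolding transpose_mult[OF B] transpose_mult[OF B(2,1)] by simp_all
qed

lemma line_adjacency_matrix_transpose: "(line_adjacency_matrix es)\<^sup>T = line_adjacency_matrix es"
  by (intro eq_matI) (auto simp: line_adjacency_matrix_def Int_commute)

lemma incidence_gram_index:
  assumes "distinct vs" and "es ! i \<subseteq> set vs" and "i < length es" and "j < length es"
  shows "((incidence_matrix vs es)\<^sup>T * incidence_matrix vs es) $$ (i, j) =
    real (card (es ! i \<inter> es ! j))"
proof -
  have "((incidence_matrix vs es)\<^sup>T * incidence_matrix vs es) $$ (i, j) =
      (\<Sum>l = 0..<length vs. if vs ! l \<in> es ! i \<inter> es ! j then 1 else 0)"
    using assms by (auto simp: incidence_matrix_def scalar_prod_def intro!: sum.cong)
  also have "\<dots> = (\<Sum>v\<leftarrow>vs. if v \<in> es ! i \<inter> es ! j then 1 else 0)"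
    by (simp add: sum_list_sum_nth)
  also have "\<dots> = (\<Sum>v\<in>set vs. if v \<in> es ! i \<inter> es ! j then 1 else 0)"
    using assms by (intro sum_list_distinct_conv_sum_set)
  also have "\<dots> = real (card (set vs \<inter> (es ! i \<inter> es ! j)))"
    by (simp add: sum.If_cases del: Int_iff)
  also have "set vs \<inter> (es ! i \<inter> es ! j) = es ! i \<inter> es ! j" using assms by blast
  finally show ?thesis .
qed

lemma signless_laplacian_index:
  assumes "i < length vs" and "j < length vs"
  shows "signless_laplacian vs es $$ (i, j) =
    (\<Sum>l<length es. if vs ! i \<in> es ! l \<and> vs ! j \<in> es ! l then 1 else 0)"
  using assms unfolding signless_laplacian_def
  by (auto simp: incidence_matrix_def scalar_prod_def atLeast0LessThan intro!: sum.cong)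

section \<open>Spectra attached to a uniform hypergraph\<close>

context
  fixes k :: nat and vs :: "'a list" and es :: "'a set list"
  assumes hyp: "uniform_hypergraph k (set vs) (set es)"
    and dvs: "distinct vs" and des: "distinct es"
begin

abbreviation (input) "gram \<equiv> (incidence_matrix vs es)\<^sup>T * incidence_matrix vs es"

lemma uniform_edge: "j < length es \<Longrightarrow> es ! j \<subseteq> set vs" "j < length es \<Longrightarrow> card (es ! j) = k"
  using hyp by (auto simp: uniform_hypergraph_def)

lemma gram_carrier: "gram \<in> carrier_mat (length es) (length es)"
  by (simp add: incidence_matrix_def carrier_matI)

lemma gram_eq: "gram = line_adjacency_matrix es + real k \<cdot>\<^sub>m 1\<^sub>m (length es)"
proof (rule eq_matI)
  fix i j
  assume "i < dim_row (line_adjacency_matrix es + real k \<cdot>\<^sub>m 1\<^sub>m (length es))"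
    and "j < dim_col (line_adjacency_matrix es + real k \<cdot>\<^sub>m 1\<^sub>m (length es))"
  hence "i < length es" "j < length es" by auto
  thus "gram $$ (i, j) = (line_adjacency_matrix es + real k \<cdot>\<^sub>m 1\<^sub>m (length es)) $$ (i, j)"
    using uniform_edge(2) by (simp add: incidence_gram_index[OF dvs uniform_edge(1)])
      (auto simp: line_adjacency_matrix_def)
qed (auto simp: incidence_matrix_def)

text \<open>The shift by \<open>k\<close> turns the energy of the line multigraph into a sum of
  absolute deviations from \<open>k\<close>, the mean of the spectrum of
  \<open>gram\<close>.\<close>

lemma matrix_energy_line_adjacency:
  "matrix_energy (line_adjacency_matrix es) = (\<Sum>x\<in>#eigenvalues gram. \<bar>x - real k\<bar>)"
  unfolding gram_eq matrix_energy_def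
    eigenvalues_add_scalar[OF line_adjacency_matrix_carrier line_adjacency_matrix_transpose]
  by (simp add: multiset.map_comp o_def)

lemma size_eigenvalues_gram: "size (eigenvalues gram) = length es"
  by (rule size_eigenvalues_symmetric[OF gram_carrier transpose_gram(2)])

lemma size_eigenvalues_signless_laplacian:
  "size (eigenvalues (signless_laplacian vs es)) = length vs"
  by (rule size_eigenvalues_symmetric[OF signless_laplacian_carrier])
    (simp add: signless_laplacian_def transpose_gram)

lemma sum_eigenvalues_gram: "\<Sum>\<^sub># (eigenvalues gram) = real k * real (length es)"
proof -
  have "\<Sum>\<^sub># (eigenvalues gram) = mat_trace gram"
    by (rule sum_eigenvalues_symmetric[OF gram_carrier transpose_gram(2)])
  also have "\<dots> = (\<Sum>i<length es. real k)"
    unfolding mat_trace_def using gram_carrier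
    by (intro sum.cong) (auto simp: incidence_gram_index[OF dvs uniform_edge(1)] uniform_edge(2)
        simp del: index_mult_mat(1))
  finally show ?thesis by simp
qed

lemma eigenvalues_signless_laplacian:
  "eigenvalues (signless_laplacian vs es) + replicate_mset (length es) 0 =
   eigenvalues gram + replicate_mset (length vs) 0"
  unfolding signless_laplacian_def by (rule eigenvalues_mult_commute) auto

lemma sum_eigenvalues_signless_laplacian:
  "\<Sum>\<^sub># (eigenvalues (signless_laplacian vs es)) = real k * real (length es)"
  using arg_cong[OF eigenvalues_signless_laplacian, of sum_mset] sum_eigenvalues_gram
  by simp

text \<open>This is the equality case for \<open>m < n\<close>. A scalar \<open>gram\<close> has
  zero off-diagonal entries, and these are the sizes of the intersections of different
  edges.\<close>

lemma eigenvalues_gram_const_iff: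
  "(\<forall>x\<in>#eigenvalues gram. x = real k) \<longleftrightarrow> pairwise disjnt (set es)"
proof
  assume "\<forall>x\<in>#eigenvalues gram. x = real k"
  hence eq: "gram = real k \<cdot>\<^sub>m 1\<^sub>m (length es)"
    by (rule symmetric_eq_scalar_if_eigenvalues_eq[OF gram_carrier transpose_gram(2)])
  show "pairwise disjnt (set es)"
  proof (rule pairwiseI)
    fix e f assume "e \<in> set es" "f \<in> set es" "e \<noteq> f"
    then obtain i j where ij: "i < length es" "j < length es" "e = es ! i" "f = es ! j" "i \<noteq> j"
      by (metis in_set_conv_nth)
    have "real (card (e \<inter> f)) = gram $$ (i, j)"
      using ij incidence_gram_index[OF dvs uniform_edge(1)] by simp
    also have "\<dots> = 0" unfolding eq using ij by simp
    finally have "card (e \<inter> f) = 0" by simp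
    \<comment> \<open>Needed because \<open>card\<close> is also zero on infinite sets.\<close>
    moreover have "finite (e \<inter> f)" using ij uniform_edge(1) finite_subset by blast
    ultimately show "disjnt e f" by (simp add: disjnt_def)
  qed
next
  assume dis: "pairwise disjnt (set es)"
  have "es ! i \<inter> es ! j = {}" if "i < length es" "j < length es" "i \<noteq> j" for i j
    using pairwiseD[OF dis, of "es ! i" "es ! j"] that des
    by (auto simp: disjnt_def nth_eq_iff_index_eq)
  \<comment> \<open>With disjoint edges \<open>gram\<close> is its own triangular form, so its
    spectrum is its diagonal.\<close>
  hence "upper_triangular gram" "diag_mat gram = replicate (length es) (real k)"
    unfolding gram_eq
    by (auto simp: upper_triangular_def diag_mat_def line_adjacency_matrix_def
        intro!: nth_equalityI)
  with eigenvalues_similar_upper_triangular[OF gram_carrier _ similar_mat_refl[OF gram_carrier]]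
  show "\<forall>x\<in>#eigenvalues gram. x = real k" by simp
qed

text \<open>This excludes equality in the upper bound for \<open>m > n\<close>.\<close>

lemma eigenvalues_signless_laplacian_not_const:
  assumes "es \<noteq> []"
  shows "\<not> (\<forall>x\<in>#eigenvalues (signless_laplacian vs es). x = c)"
proof
  let ?Q = "signless_laplacian vs es"
  assume "\<forall>x\<in>#eigenvalues ?Q. x = c"
  hence eq: "?Q = c \<cdot>\<^sub>m 1\<^sub>m (length vs)"
    by (intro symmetric_eq_scalar_if_eigenvalues_eq)
      (simp_all add: signless_laplacian_def[of vs es] transpose_gram
        signless_laplacian_carrier[unfolded signless_laplacian_def])
  have 0: "0 < length es" using assms by simp
  have "\<not> card (es ! 0) \<le> 1" using uniform_edge(2)[OF 0] hyp by (simp add: uniform_hypergraph_def)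
  moreover have "finite (es ! 0)" using uniform_edge(1)[OF 0] finite_subset by blast
  ultimately obtain u v where uv: "u \<in> es ! 0" "v \<in> es ! 0" "u \<noteq> v"
    by (auto simp: card_le_Suc0_iff_eq)
  then obtain i j where ij: "i < length vs" "j < length vs" "u = vs ! i" "v = vs ! j" "i \<noteq> j"
    using uniform_edge(1)[OF 0] by (metis in_set_conv_nth subsetD)
  let ?f = "\<lambda>l. if vs ! i \<in> es ! l \<and> vs ! j \<in> es ! l then 1 else 0 :: real"
  have "?f 0 \<le> (\<Sum>l<length es. ?f l)" using 0 by (intro member_le_sum) auto
  hence "1 \<le> ?Q $$ (i, j)" using ij uv by (simp add: signless_laplacian_index)
  thus False unfolding eq using ij by simp
qed

end

section \<open>Comparison of the two energies\<close>

theorem theorem27: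
  fixes V :: "'a set" and E :: "'a set set" and k n m :: nat
    and vs :: "'a list" and es :: "'a set list" and QE EL :: real
  assumes "uniform_hypergraph k V E"
    and "card V = n" and "card E = m" and "m \<ge> 1"
    and "enumeration vs V" and "enumeration es E"
    and "QE = signless_laplacian_energy k vs es"
    and "EL = matrix_energy (line_adjacency_matrix es)"
  shows "(m = n \<longrightarrow> QE = EL) \<and>
    (m < n \<longrightarrow>
       QE - 2 * real k * real m * (real n - real m) / real n \<le> EL \<and> EL < QE \<and>
       (QE - 2 * real k * real m * (real n - real m) / real n = EL \<longleftrightarrow> pairwise disjnt E)) \<and>
    (m > n \<longrightarrow> QE < EL \<and> EL < QE + 2 * real k * (real m - real n))"
proof -
  have V: "set vs = V" "distinct vs" and E: "set es = E" "distinct es"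
    using assms by (auto simp: enumeration_def)
  have lens: "length vs = n" "length es = m"
    using V E assms distinct_card by fastforce+
  have hyp: "uniform_hypergraph k (set vs) (set es)" using assms V E by simp
  note facts = hyp V(2) E(2)
  define X where "X = eigenvalues (signless_laplacian vs es)"
  define Y where "Y = eigenvalues ((incidence_matrix vs es)\<^sup>T * incidence_matrix vs es)"
  define d where "d = real k * real m / real n"
  have k: "k \<ge> 2" using hyp by (simp add: uniform_hypergraph_def)
  have "es \<noteq> []" using lens \<open>m \<ge> 1\<close> by auto
  hence "es ! 0 \<subseteq> set vs" "card (es ! 0) = k" using uniform_edge[OF facts] by auto
  \<comment> \<open>An edge with at least two vertices lies in \<open>V\<close>; hence the division
    by \<open>n\<close> in \<open>d\<close> is a genuine one.\<close>
  hence n: "n \<ge> 1" using k lens by (cases vs) auto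
  have QE: "QE = (\<Sum>x\<in>#X. \<bar>x - d\<bar>)"
    by (simp add: assms signless_laplacian_energy_def average_degree_def X_def d_def lens)
  have EL: "EL = (\<Sum>x\<in>#Y. \<bar>x - real k\<bar>)"
    using matrix_energy_line_adjacency[OF facts] assms by (simp add: Y_def)
  have XY: "X + replicate_mset m 0 = Y + replicate_mset n 0"
    using eigenvalues_signless_laplacian[OF facts] by (simp add: X_def Y_def lens)
  have size: "size X = n" "size Y = m"
    using size_eigenvalues_gram[OF facts] size_eigenvalues_signless_laplacian[OF facts]
    by (simp_all add: X_def Y_def lens)
  have sumY: "\<Sum>\<^sub># Y = real (size Y) * real k"
    using sum_eigenvalues_gram[OF facts] by (simp add: Y_def[symmetric] lens size)
  have sumX: "\<Sum>\<^sub># X = real (size X) * d"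
    using sum_eigenvalues_signless_laplacian[OF facts] n
    by (simp add: X_def[symmetric] d_def lens size)
  have "QE = EL" if "m = n"
    using that XY QE EL n by (simp add: d_def)
  moreover have "QE - 2 * real k * real m * (real n - real m) / real n \<le> EL \<and> EL < QE \<and>
       (QE - 2 * real k * real m * (real n - real m) / real n = EL \<longleftrightarrow> pairwise disjnt E)"
    if "m < n"
  proof -
    have "X + replicate_mset m 0 = (Y + replicate_mset (n - m) 0) + replicate_mset m 0"
      unfolding XY using that by (simp add: multiset_eq_iff)
    hence "X = Y + replicate_mset (n - m) 0" by simp
    \<comment> \<open>Each of the \<open>n - m\<close> additional zeros has deviation
      \<open>d\<close>.\<close>
    hence "QE = (\<Sum>x\<in>#Y. \<bar>x - d\<bar>) + (real n - real m) * d"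
      using QE that by (simp add: d_def of_nat_diff)
    \<comment> \<open>Both identities follow from \<open>d * n = k * m\<close>. The subtracted term
      of the theorem is thus twice the contribution of the zeros.\<close>
    moreover have extra: "(real n - real m) * d = real (size Y) * (real k - d)"
      "2 * real k * real m * (real n - real m) / real n = 2 * (real (size Y) * (real k - d))"
      using n by (simp_all add: d_def size field_simps)
    ultimately have QE': "QE = (\<Sum>x\<in>#Y. \<bar>x - d\<bar>) + real (size Y) * (real k - d)" by simp
    have "d < real k" using that n k by (simp add: d_def field_simps)
    moreover have "Y \<noteq> {#}" using size \<open>m \<ge> 1\<close> by auto
    \<comment> \<open>The factor 2 collects one share from the additional zeros and one from the
      comparison of deviations.\<close>
    ultimately have cmp: "EL < QE"
      "QE \<le> EL + 2 * (real (size Y) * (real k - d))"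
      "QE = EL + 2 * (real (size Y) * (real k - d)) \<longleftrightarrow> (\<forall>x\<in>#Y. x = real k)"
      using abs_deviation_comparison[of Y "real k" d] sumY EL QE' by auto
    have "(\<forall>x\<in>#Y. x = real k) \<longleftrightarrow> pairwise disjnt E"
      using eigenvalues_gram_const_iff[OF facts] by (simp add: Y_def E(1))
    with cmp show ?thesis unfolding extra(2) by auto
  qed
  moreover have "QE < EL \<and> EL < QE + 2 * real k * (real m - real n)" if "m > n"
  proof -
    \<comment> \<open>The mirror image of the previous case: \<open>X\<close> is now the smaller
      spectrum, with mean \<open>d\<close> above \<open>k\<close>.\<close>
    have "Y + replicate_mset n 0 = (X + replicate_mset (m - n) 0) + replicate_mset n 0"
      unfolding XY[symmetric] using that by (simp add: multiset_eq_iff)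
    hence "Y = X + replicate_mset (m - n) 0" by simp
    hence "EL = (\<Sum>x\<in>#X. \<bar>x - real k\<bar>) + (real m - real n) * real k"
      using EL that by (simp add: of_nat_diff)
    moreover have extra: "real (size X) * (d - real k) = (real m - real n) * real k"
      using n by (simp add: d_def size field_simps)
    ultimately have EL': "EL = (\<Sum>x\<in>#X. \<bar>x - real k\<bar>) + real (size X) * (d - real k)" by simp
    have "real k < d" using that n k by (simp add: d_def field_simps)
    moreover have "X \<noteq> {#}" using size n by auto
    ultimately have cmp: "QE < EL"
      "EL \<le> QE + 2 * (real (size X) * (d - real k))"
      "EL = QE + 2 * (real (size X) * (d - real k)) \<longleftrightarrow> (\<forall>x\<in>#X. x = d)"
      using abs_deviation_comparison[of X d "real k"] sumX QE EL' by auto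
    have "\<not> (\<forall>x\<in>#X. x = d)"
      using eigenvalues_signless_laplacian_not_const[OF facts \<open>es \<noteq> []\<close>] by (simp add: X_def)
    with cmp show ?thesis unfolding extra by (auto simp: algebra_simps)
  qed
  ultimately show ?thesis by blast
qed

end
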